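(* Let $P=\frac13P_1+\frac23P_2$, where $P_1$ and $P_2$ are the uniform distributions on $[0,1]$ and $[1,2]$, respectively. The optimal set of two-means for $P$ is $\{\frac12,\frac32\}$, with quantization error $V_2=\frac1{12}$.
   Context: For a Borel probability measure $P$ on $\mathbb{R}$ and $n\in\mathbb{N}$, the $n$th quantization error is $V_n=V_n(P)=\inf\{\int\min_{a\in\alpha}(x-a)^2\,dP(x) : \alpha\subset\mathbb{R},\ 1\le\mathrm{card}(\alpha)\le n\}$, and an optimal set of $n$-means for $P$ is a set $\alpha$ with $1\le\mathrm{card}(\alpha)\le n$ attaining this infimum. *)

theory Defs
  imports "HOL-Probability.Probability"
begin

definition mixture :: "real \<Rightarrow> 'a measure \<Rightarrow> real \<Rightarrow> 'a measure \<Rightarrow> 'a measure" where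
  "mixture p M q N =
     measure_of (space M) (sets M)
       (\<lambda>A. ennreal p * emeasure M A + ennreal q * emeasure N A)"

text \<open>
  For measures on the same sigma-algebra the set function above is countably additive, so
  \<^const>\<open>measure_of\<close> does not fall back to the zero measure:
\<close>

lemma sets_mixture [simp, measurable_cong]: "sets (mixture p M q N) = sets M"
  by (simp add: mixture_def)

lemma space_mixture [simp]: "space (mixture p M q N) = space M"
  by (simp add: mixture_def)

lemma emeasure_mixture:
  assumes "sets M = sets N" and "A \<in> sets M"
  shows "emeasure (mixture p M q N) A
           = ennreal p * emeasure M A + ennreal q * emeasure N A"
proof (rule emeasure_measure_of[OF mixture_def])
  show "sets M \<subseteq> Pow (space M)" by (rule sets.space_closed)
  show "A \<in> sets (mixture p M q N)" using assms by simp
  show "positive (sets (mixture p M q N))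
          (\<lambda>A. ennreal p * emeasure M A + ennreal q * emeasure N A)"
    by (simp add: positive_def)
  show "countably_additive (sets (mixture p M q N))
          (\<lambda>A. ennreal p * emeasure M A + ennreal q * emeasure N A)"
  proof (rule countably_additiveI)
    fix F :: "nat \<Rightarrow> 'a set"
    assume F: "range F \<subseteq> sets (mixture p M q N)" "disjoint_family F"
    then have M: "range F \<subseteq> sets M" and N: "range F \<subseteq> sets N"
      using assms(1) by auto
    show "(\<Sum>i. ennreal p * emeasure M (F i) + ennreal q * emeasure N (F i))
            = ennreal p * emeasure M (\<Union>i. F i) + ennreal q * emeasure N (\<Union>i. F i)"
      by (simp add: suminf_add[symmetric] suminf_emeasure[OF M F(2)] suminf_emeasure[OF N F(2)])
  qed
qed

lemma prob_space_mixture: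
  assumes "prob_space M" and "prob_space N" and "sets M = sets N"
    and "0 \<le> p" and "0 \<le> q" and "p + q = 1"
  shows "prob_space (mixture p M q N)"
proof (rule prob_spaceI)
  have "emeasure M (space M) = 1"
    using assms(1) by (rule prob_space.emeasure_space_1)
  moreover have "emeasure N (space M) = 1"
    unfolding sets_eq_imp_space_eq[OF assms(3)] using assms(2) by (rule prob_space.emeasure_space_1)
  ultimately show "emeasure (mixture p M q N) (space (mixture p M q N)) = 1"
    using assms(4-6)
    by (simp add: emeasure_mixture[OF assms(3)] ennreal_plus[symmetric] del: ennreal_plus)
qed

text \<open>
  The distortion is a nonnegative Lebesgue integral: it is \<open>\<infinity>\<close>, rather than \<open>0\<close>, when the
  integrand is not integrable.  It is meant for finite nonempty \<open>\<alpha>\<close>; the condition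
  \<open>1 \<le> card \<alpha>\<close> below excludes the empty set and, since infinite sets have \<^const>\<open>card\<close> zero,
  the infinite ones.
\<close>

definition distortion :: "real measure \<Rightarrow> real set \<Rightarrow> ennreal" where
  "distortion P \<alpha> = (\<integral>\<^sup>+ x. ennreal (Min ((\<lambda>a. (x - a)\<^sup>2) ` \<alpha>)) \<partial>P)"

definition quantization_error :: "real measure \<Rightarrow> nat \<Rightarrow> ennreal" where
  "quantization_error P n = Inf {distortion P \<alpha> | \<alpha>. 1 \<le> card \<alpha> \<and> card \<alpha> \<le> n}"

definition optimal_n_means :: "real measure \<Rightarrow> nat \<Rightarrow> real set \<Rightarrow> bool" where
  "optimal_n_means P n \<alpha> \<longleftrightarrow>
     1 \<le> card \<alpha> \<and> card \<alpha> \<le> n \<and> distortion P \<alpha> = quantization_error P n"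

end

theory Submission
  imports Defs
begin

text \<open>
  The measure has density \<open>1/3\<close> on \<open>[0,1]\<close> and \<open>2/3\<close> on \<open>[1,2]\<close>.  Two means \<open>a \<le> b\<close> split
  the line at their midpoint: points to its left are charged to \<open>a\<close>, the others to \<open>b\<close>.
  Hence the distortion of \<open>{a, b}\<close> is a polynomial in \<open>a\<close>, \<open>b\<close> and a splitting point \<open>c\<close>, and it
  is enough to minimise that polynomial over all \<open>a\<close>, \<open>b\<close> and all \<open>c \<in> [0,2]\<close>, forgetting that
  \<open>c\<close> is tied to \<open>a\<close> and \<open>b\<close>.

  One of the two means serves only a part of one of the two intervals, and its cost is least
  when it is the centre of that part.  Measure the distance of \<open>c\<close> from \<open>1\<close> by \<open>t\<close>, and the
  displacement of the other mean from the centre of the interval that it serves completely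
  by \<open>w / 2\<close>.  The excess of the cost over \<open>1/12\<close> is then a quadratic polynomial in \<open>w\<close> whose
  coefficients depend on \<open>t\<close>.  Completing the square in \<open>w\<close> shows that it is nonnegative and
  vanishes only for \<open>t = w = 0\<close>, so that \<open>c = 1\<close>, \<open>a = 1/2\<close> and \<open>b = 3/2\<close>.  The two sides of \<open>1\<close>
  carry different densities, so the cases \<open>c \<le> 1\<close> and \<open>c \<ge> 1\<close> need different polynomials:
  lemmas \<open>split_cost_left\<close> and \<open>split_cost_right\<close>.
\<close>

section \<open>Integrals against a mixture of uniform distributions\<close>

lemma mixture_density:
  assumes [measurable]: "f \<in> borel_measurable M" "g \<in> borel_measurable M"
  shows "mixture p (density M f) q (density M g) = density M (\<lambda>x. ennreal p * f x + ennreal q * g x)"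
proof (rule measure_eqI)
  fix A assume "A \<in> sets (mixture p (density M f) q (density M g))"
  then have [measurable]: "A \<in> sets M" by simp
  have "emeasure (density M (\<lambda>x. ennreal p * f x + ennreal q * g x)) A
      = (\<integral>\<^sup>+x. ennreal p * (f x * indicator A x) + ennreal q * (g x * indicator A x) \<partial>M)"
    by (simp add: emeasure_density distrib_right mult.assoc)
  also have "\<dots> = ennreal p * emeasure (density M f) A + ennreal q * emeasure (density M g) A"
    by (simp add: nn_integral_add nn_integral_cmult emeasure_density)
  finally show "emeasure (mixture p (density M f) q (density M g)) A
      = emeasure (density M (\<lambda>x. ennreal p * f x + ennreal q * g x)) A"
    by (simp add: emeasure_mixture)
qed simp

lemma nn_integral_mixture_unit_intervals:
  fixes f :: "real \<Rightarrow> ennreal" and k l :: real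
  assumes [measurable]: "f \<in> borel_measurable borel"
  shows "(\<integral>\<^sup>+x. f x \<partial>mixture p (uniform_measure lborel {k..k+1}) q (uniform_measure lborel {l..l+1}))
    = ennreal p * (\<integral>\<^sup>+x. f x * indicator {k..k+1} x \<partial>lborel)
    + ennreal q * (\<integral>\<^sup>+x. f x * indicator {l..l+1} x \<partial>lborel)"
proof -
  have "(\<integral>\<^sup>+x. f x \<partial>mixture p (uniform_measure lborel {k..k+1}) q (uniform_measure lborel {l..l+1}))
    = (\<integral>\<^sup>+x. ennreal p * (f x * indicator {k..k+1} x) + ennreal q * (f x * indicator {l..l+1} x) \<partial>lborel)"
    unfolding uniform_measure_def
    by (subst mixture_density)
       (auto simp: divide_ennreal_def nn_integral_density ac_simps distrib_left intro!: nn_integral_cong)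
  then show ?thesis
    by (simp add: nn_integral_add nn_integral_cmult)
qed

section \<open>The distortion of a pair as the cost of a split\<close>

definition square_cost :: "real \<Rightarrow> real \<Rightarrow> real \<Rightarrow> real" where
  "square_cost l u a = ((u - a)^3 - (l - a)^3) / 3"

lemma nn_integral_square_cost:
  assumes "l \<le> u"
  shows "(\<integral>\<^sup>+x. ennreal ((x - a)\<^sup>2) * indicator {l..u} x \<partial>lborel) = ennreal (square_cost l u a)"
proof -
  have "(\<integral>\<^sup>+x. ennreal ((x - a)\<^sup>2) * indicator {l..u} x \<partial>lborel)
      = ennreal ((u - a)^3 / 3 - (l - a)^3 / 3)"
    using assms
    by (intro nn_integral_FTC_Icc[where F = "\<lambda>x. (x - a)^3 / 3"])
       (auto intro!: derivative_eq_intros simp: power2_eq_square)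
  then show ?thesis
    by (simp add: square_cost_def diff_divide_distrib)
qed

text \<open>
  The bias-variance decomposition: centring is the best choice, which disposes of the
  mean that serves only part of an interval.
\<close>

lemma square_cost_centre:
  "square_cost l u a = (u - l)^3 / 12 + (u - l) * (a - (l + u) / 2)\<^sup>2"
  unfolding square_cost_def by (simp add: field_simps power2_eq_square power3_eq_cube)

lemma square_cost_nonneg: "l \<le> u \<Longrightarrow> 0 \<le> square_cost l u a"
  by (simp add: square_cost_centre)

text \<open>
  Clamping the midpoint of \<open>a\<close> and \<open>b\<close> to \<open>[l,u]\<close> covers at once the three possible positions of
  the midpoint relative to the interval.
\<close>

lemma nn_integral_Min_pair:
  fixes a b l u :: real
  assumes "a \<le> b" "l \<le> u"
  defines "c \<equiv> max l (min u ((a + b) / 2))"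
  shows "(\<integral>\<^sup>+x. ennreal (Min ((\<lambda>z. (x - z)\<^sup>2) ` {a, b})) * indicator {l..u} x \<partial>lborel)
    = ennreal (square_cost l c a + square_cost c u b)"
proof -
  have c: "l \<le> c" "c \<le> u" using assms by auto
  have diff: "(x - b)\<^sup>2 = (x - a)\<^sup>2 + 2 * ((b - a) * ((a + b) / 2 - x))" for x
    by (simp add: field_simps power2_eq_square)
  have left: "(x - a)\<^sup>2 \<le> (x - b)\<^sup>2" if "x \<le> (a + b) / 2" for x
  proof -
    have "0 \<le> (b - a) * ((a + b) / 2 - x)"
      using assms(1) that by (intro mult_nonneg_nonneg) auto
    then show ?thesis using diff[of x] by linarith
  qed
  have right: "(x - b)\<^sup>2 \<le> (x - a)\<^sup>2" if "(a + b) / 2 \<le> x" for x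
  proof -
    have "(b - a) * ((a + b) / 2 - x) \<le> 0"
      using assms(1) that by (intro mult_nonneg_nonpos) auto
    then show ?thesis using diff[of x] by linarith
  qed
  \<comment> \<open>the two closed pieces overlap in the null set \<open>{c}\<close>\<close>
  have "AE x in lborel. x \<noteq> c" by (rule AE_lborel_singleton)
  then have "AE x in lborel. ennreal (Min ((\<lambda>z. (x - z)\<^sup>2) ` {a, b})) * indicator {l..u} x
    = ennreal ((x - a)\<^sup>2) * indicator {l..c} x + ennreal ((x - b)\<^sup>2) * indicator {c..u} x"
  proof eventually_elim
    case (elim x)
    consider "x < l \<or> u < x" | "l \<le> x" "x < c" | "c < x" "x \<le> u"
      using elim by linarith
    then show ?case
    proof cases
      case 1
      then show ?thesis using c by (auto simp: indicator_def)
    next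
      case 2
      then have "x \<le> (a + b) / 2" by (auto simp: c_def less_max_iff_disj)
      then show ?thesis using left[of x] 2 c by (simp add: min_def)
    next
      case 3
      then have "(a + b) / 2 \<le> x" by (auto simp: c_def min_less_iff_disj)
      then show ?thesis using right[of x] 3 c by (simp add: min.absorb2)
    qed
  qed
  then have "(\<integral>\<^sup>+x. ennreal (Min ((\<lambda>z. (x - z)\<^sup>2) ` {a, b})) * indicator {l..u} x \<partial>lborel)
    = (\<integral>\<^sup>+x. ennreal ((x - a)\<^sup>2) * indicator {l..c} x + ennreal ((x - b)\<^sup>2) * indicator {c..u} x \<partial>lborel)"
    by (rule nn_integral_cong_AE)
  also have "\<dots> = ennreal (square_cost l c a + square_cost c u b)"
    using c by (simp add: nn_integral_add nn_integral_square_cost square_cost_nonneg)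
  finally show ?thesis .
qed

definition pair_cost :: "real \<Rightarrow> real \<Rightarrow> real" where
  "pair_cost a b =
     (let c = max 0 (min 1 ((a + b) / 2)); d = max 1 (min 2 ((a + b) / 2)) in
        1/3 * (square_cost 0 c a + square_cost c 1 b) + 2/3 * (square_cost 1 d a + square_cost d 2 b))"

lemma distortion_pair:
  assumes "a \<le> b"
  shows "distortion (mixture (1/3) (uniform_measure lborel {0..1}) (2/3) (uniform_measure lborel {1..2})) {a, b}
    = ennreal (pair_cost a b)"
proof -
  let ?f = "\<lambda>x. ennreal (Min ((\<lambda>z. (x - z)\<^sup>2) ` {a, b}))"
  have "?f \<in> borel_measurable borel" by simp
  from nn_integral_mixture_unit_intervals[OF this, of "1/3" 0 "2/3" 1]
  show ?thesis
    unfolding distortion_def pair_cost_def Let_def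
    using nn_integral_Min_pair[OF assms, of 0 1] nn_integral_Min_pair[OF assms, of 1 2]
    by (simp add: ennreal_mult[symmetric] ennreal_plus[symmetric] square_cost_nonneg del: ennreal_plus)
qed

section \<open>Minimising the cost of a split\<close>

text \<open>
  \<open>S\<close> is three times the cost of splitting at \<open>c\<close>, so \<open>1/4\<close> stands for the error \<open>1/12\<close>.  Its excess
  over \<open>1/4\<close> has two parts: the bias of \<open>a\<close> as a centre of \<open>[0,c]\<close>, and a form \<open>Q\<close>, quadratic in
  \<open>w\<close>, that is positive unless \<open>t = w = 0\<close>.  The leading coefficient \<open>2 + t\<close> of \<open>Q\<close>
  is positive, so \<open>Q\<close> has the sign of \<open>(2 + t) Q\<close>, in which the square can be completed without
  division.  The bias forces \<open>a = c / 2\<close> only because \<open>c\<close> is already known to be \<open>1\<close>, not \<open>0\<close>.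
\<close>

lemma split_cost_left:
  fixes a b c :: real
  assumes "0 \<le> c" "c \<le> 1"
  defines "S \<equiv> square_cost 0 c a + square_cost c 1 b + 2 * square_cost 1 2 b"
  shows "1/4 \<le> S" and "S = 1/4 \<Longrightarrow> a = 1/2 \<and> b = 3/2"
proof -
  define t w where "t = 1 - c" and "w = 2 * b - 3"
  define Q where "Q = (2 + t) * w\<^sup>2 + 2 * t * (1 + t) * w + t^3 + 3 * t\<^sup>2"
  have cb: "c = 1 - t" "b = (3 + w) / 2" by (auto simp: t_def w_def)
  have t: "0 \<le> t" using assms by (simp add: t_def)
  have S: "S = 1/4 + c * (a - c / 2)\<^sup>2 + Q / 4"
    unfolding S_def square_cost_def Q_def cb
    by (simp add: field_simps power2_eq_square power3_eq_cube)
  have Q: "(2 + t) * Q = ((2 + t) * w + t * (1 + t))\<^sup>2 + t\<^sup>2 * (5 + 3 * t)"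
    unfolding Q_def by (simp add: algebra_simps power2_eq_square power3_eq_cube)
  have "0 \<le> (2 + t) * Q" unfolding Q using t by simp
  then have Q0: "0 \<le> Q" using t by (simp add: zero_le_mult_iff)
  have ca: "0 \<le> c * (a - c / 2)\<^sup>2" using assms by simp
  show "1/4 \<le> S" using S Q0 ca by linarith
  assume "S = 1/4"
  then have "Q = 0" and a: "c * (a - c / 2)\<^sup>2 = 0" using S Q0 ca by linarith+
  then have "((2 + t) * w + t * (1 + t))\<^sup>2 + t\<^sup>2 * (5 + 3 * t) = 0" using Q by simp
  then have "(2 + t) * w + t * (1 + t) = 0 \<and> t\<^sup>2 * (5 + 3 * t) = 0"
    using t by (subst (asm) add_nonneg_eq_0_iff) auto
  then have "t = 0" "w = 0" using t by auto
  then show "a = 1/2 \<and> b = 3/2" using a cb by simp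
qed

text \<open>
  The mirror image of the previous lemma, with \<open>b\<close> serving only \<open>[c,2]\<close>.  The quadratic form is a
  different one because the mean that crosses \<open>1\<close> now takes a piece from the denser interval.
\<close>

lemma split_cost_right:
  fixes a b c :: real
  assumes "1 \<le> c" "c \<le> 2"
  defines "S \<equiv> square_cost 0 1 a + 2 * (square_cost 1 c a + square_cost c 2 b)"
  shows "1/4 \<le> S" and "S = 1/4 \<Longrightarrow> a = 1/2 \<and> b = 3/2"
proof -
  define t w where "t = c - 1" and "w = 2 * a - 1"
  define Q where "Q = (1 + 2 * t) * w\<^sup>2 - 4 * t * (1 + t) * w + 2 * t^3 + 6 * t\<^sup>2"
  have ca: "c = 1 + t" "a = (1 + w) / 2" by (auto simp: t_def w_def)
  have t: "0 \<le> t" using assms by (simp add: t_def)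
  have S: "S = 1/4 + 2 * (2 - c) * (b - (c + 2) / 2)\<^sup>2 + Q / 4"
    unfolding S_def square_cost_def Q_def ca
    by (simp add: field_simps power2_eq_square power3_eq_cube)
  have Q: "(1 + 2 * t) * Q = ((1 + 2 * t) * w - 2 * t * (1 + t))\<^sup>2 + 2 * t\<^sup>2 * (1 + 3 * t)"
    unfolding Q_def by (simp add: algebra_simps power2_eq_square power3_eq_cube)
  have "0 \<le> (1 + 2 * t) * Q" unfolding Q using t by simp
  then have Q0: "0 \<le> Q" using t by (simp add: zero_le_mult_iff)
  have cb: "0 \<le> 2 * (2 - c) * (b - (c + 2) / 2)\<^sup>2" using assms by simp
  show "1/4 \<le> S" using S Q0 cb by linarith
  assume "S = 1/4"
  then have "Q = 0" and b: "2 * (2 - c) * (b - (c + 2) / 2)\<^sup>2 = 0" using S Q0 cb by linarith+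
  then have "((1 + 2 * t) * w - 2 * t * (1 + t))\<^sup>2 + 2 * t\<^sup>2 * (1 + 3 * t) = 0" using Q by simp
  then have "(1 + 2 * t) * w - 2 * t * (1 + t) = 0 \<and> 2 * t\<^sup>2 * (1 + 3 * t) = 0"
    using t by (subst (asm) add_nonneg_eq_0_iff) auto
  then have "t = 0" "w = 0" using t by auto
  then show "a = 1/2 \<and> b = 3/2" using b ca by simp
qed

lemma pair_cost_ge: "1/12 \<le> pair_cost a b"
  and pair_cost_eq_imp: "pair_cost a b = 1/12 \<Longrightarrow> a = 1/2 \<and> b = 3/2"
proof -
  have "1/12 \<le> pair_cost a b \<and> (pair_cost a b = 1/12 \<longrightarrow> a = 1/2 \<and> b = 3/2)"
  proof (cases "(a + b) / 2 \<le> 1")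
    case True
    define c where "c = max 0 (min 1 ((a + b) / 2))"
    have c: "0 \<le> c" "c \<le> 1" by (auto simp: c_def)
    have "max 1 (min 2 ((a + b) / 2)) = 1" using True by simp
    then have "3 * pair_cost a b = square_cost 0 c a + square_cost c 1 b + 2 * square_cost 1 2 b"
      by (simp add: pair_cost_def Let_def c_def[symmetric] square_cost_centre[of 1 1])
    then show ?thesis using split_cost_left[OF c, of a b] by auto
  next
    case False
    define c where "c = max 1 (min 2 ((a + b) / 2))"
    have c: "1 \<le> c" "c \<le> 2" by (auto simp: c_def)
    have "max 0 (min 1 ((a + b) / 2)) = 1" using False by simp
    then have "3 * pair_cost a b = square_cost 0 1 a + 2 * (square_cost 1 c a + square_cost c 2 b)"
      by (simp add: pair_cost_def Let_def c_def[symmetric] square_cost_centre[of 1 1])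
    then show ?thesis using split_cost_right[OF c, of a b] by auto
  qed
  then show "1/12 \<le> pair_cost a b" "pair_cost a b = 1/12 \<Longrightarrow> a = 1/2 \<and> b = 3/2"
    by auto
qed

lemma pair_cost_centres: "pair_cost (1/2) (3/2) = 1/12"
  by (simp add: pair_cost_def square_cost_centre)

section \<open>Optimal sets of two means\<close>

text \<open>Allowing \<open>a = b\<close> treats a single mean as a degenerate pair.\<close>

lemma card_one_or_two_ordered_pair:
  fixes \<alpha> :: "'a :: linorder set"
  assumes "1 \<le> card \<alpha>" "card \<alpha> \<le> 2"
  obtains a b where "a \<le> b" "\<alpha> = {a, b}"
proof -
  have "card \<alpha> = 1 \<or> card \<alpha> = 2" using assms by linarith
  then obtain x y where "\<alpha> = {x, y}"
    by (metis card_1_singletonE card_2_iff insert_absorb2)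
  then show thesis
    using that[of x y] that[of y x] by (cases "x \<le> y") (auto simp: insert_commute)
qed

theorem proposition2p9p1:
  fixes P P\<^sub>1 P\<^sub>2 :: "real measure"
  defines "P\<^sub>1 \<equiv> uniform_measure lborel {0..1}"
    and "P\<^sub>2 \<equiv> uniform_measure lborel {1..2}"
    and "P \<equiv> mixture (1/3) P\<^sub>1 (2/3) P\<^sub>2"
  shows "(\<forall>\<alpha>. optimal_n_means P 2 \<alpha> \<longleftrightarrow> \<alpha> = {1/2, 3/2})
       \<and> quantization_error P 2 = ennreal (1/12)"
proof -
  have pair: "distortion P {a, b} = ennreal (pair_cost a b)" if "a \<le> b" for a b
    unfolding P_def P\<^sub>1_def P\<^sub>2_def using that by (rule distortion_pair)
  have opt: "distortion P {1/2, 3/2} = ennreal (1/12)"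
    by (simp only: pair pair_cost_centres)
  have lower: "ennreal (1/12) \<le> distortion P \<alpha>" if card: "1 \<le> card \<alpha>" "card \<alpha> \<le> 2" for \<alpha>
  proof -
    obtain a b where "a \<le> b" "\<alpha> = {a, b}"
      using card by (rule card_one_or_two_ordered_pair)
    then show ?thesis using ennreal_leI[OF pair_cost_ge[of a b]] pair by simp
  qed
  have unique: "\<alpha> = {1/2, 3/2}"
    if card: "1 \<le> card \<alpha>" "card \<alpha> \<le> 2" and eq: "distortion P \<alpha> = ennreal (1/12)" for \<alpha>
  proof -
    obtain a b where ab: "a \<le> b" "\<alpha> = {a, b}"
      using card by (rule card_one_or_two_ordered_pair)
    then have "ennreal (pair_cost a b) = ennreal (1/12)" using eq pair by simp
    then have "pair_cost a b = 1/12"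
      using pair_cost_ge[of a b] by (subst (asm) ennreal_inj) auto
    then show ?thesis using ab pair_cost_eq_imp by blast
  qed
  have card: "card {1/2, 3/2 :: real} = 2" by simp
  have err: "quantization_error P 2 = ennreal (1/12)"
    unfolding quantization_error_def
  proof (rule antisym)
    show "Inf {distortion P \<alpha> |\<alpha>. 1 \<le> card \<alpha> \<and> card \<alpha> \<le> 2} \<le> ennreal (1/12)"
      using card opt by (intro Inf_lower) (auto intro!: exI[of _ "{1/2, 3/2}"])
    show "ennreal (1/12) \<le> Inf {distortion P \<alpha> |\<alpha>. 1 \<le> card \<alpha> \<and> card \<alpha> \<le> 2}"
      using lower by (intro Inf_greatest) auto
  qed
  have "optimal_n_means P 2 \<alpha> \<longleftrightarrow> \<alpha> = {1/2, 3/2}" for \<alpha>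
    unfolding optimal_n_means_def err using unique card opt by auto
  with err show ?thesis by blast
qed

end
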